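(* Let $G$ be a connected graph of order $n$ and size $m$, and let $\nu'_1$ and $\nu'_n$ denote respectively the maximum and the minimum of the numbers $|\mu'_i-\zeta(G)/n|$, $i=1,\dots,n$. Then \[LE_\varepsilon(G)\ge\sqrt{nE_1(G)-\zeta(G)^2+2mn-\frac{n^2}{4}(\nu'_1-\nu'_n)^2}.\]
   Context: $G$ is simple with vertices $v_1,\dots,v_n$. $\varepsilon_G(v)=\max_{u} d_G(u,v)$ is the eccentricity ($d_G$ = shortest-path distance); $\zeta(G)=\sum_i\varepsilon_G(v_i)$; $E_1(G)=\sum_i\varepsilon_G(v_i)^2$. $\mu'_1,\dots,\mu'_n$ are the eigenvalues of $L_\varepsilon(G)=\varepsilon(G)-A(G)$, where $A(G)$ is the adjacency matrix and $\varepsilon(G)$ the diagonal matrix with entries $\varepsilon_G(v_i)$. $LE_\varepsilon(G)=\sum_{i=1}^n|\mu'_i-\zeta(G)/n|$. *)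

theory Defs
  imports "Graph_Theory.Graph_Theory" "Jordan_Normal_Form.Char_Poly"
begin

text \<open>
  A finite simple graph is an element of the locale \<^locale>\<open>graph\<close>: a finite symmetric digraph
  without loops and parallel arcs. Every undirected edge is thus represented by two arcs.
\<close>

definition graph_size :: "('a, 'b) pre_digraph \<Rightarrow> nat" where
  "graph_size G = card ((\<lambda>e. {tail G e, head G e}) ` arcs G)"

text \<open>
  The infimum of the lengths of the walks between two vertices, that is, the shortest-path distance.
  It is finite when the graph is connected, so nothing is lost in passing to the reals.
\<close>

definition graph_dist :: "('a, 'b) pre_digraph \<Rightarrow> 'a \<Rightarrow> 'a \<Rightarrow> real" where
  "graph_dist G u v = real_of_ereal (wf_digraph.\<mu> G (\<lambda>e. 1) u v)"

definition ecc :: "('a, 'b) pre_digraph \<Rightarrow> 'a \<Rightarrow> real" where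
  "ecc G v = Max ((\<lambda>u. graph_dist G u v) ` verts G)"

definition total_ecc :: "('a, 'b) pre_digraph \<Rightarrow> real" where
  "total_ecc G = (\<Sum>v\<in>verts G. ecc G v)"

definition first_zagreb_ecc :: "('a, 'b) pre_digraph \<Rightarrow> real" where
  "first_zagreb_ecc G = (\<Sum>v\<in>verts G. (ecc G v)\<^sup>2)"

text \<open>
  The matrices are taken with respect to an enumeration \<open>vs\<close> of the vertices, that is,
  a list with \<^prop>\<open>distinct vs\<close> and \<^prop>\<open>set vs = verts G\<close>.
\<close>

definition adj_mat :: "('a, 'b) pre_digraph \<Rightarrow> 'a list \<Rightarrow> real mat" where
  "adj_mat G vs = mat (length vs) (length vs)
     (\<lambda>(i, j). if vs ! i \<rightarrow>\<^bsub>G\<^esub> vs ! j then 1 else 0)"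

definition ecc_mat :: "('a, 'b) pre_digraph \<Rightarrow> 'a list \<Rightarrow> real mat" where
  "ecc_mat G vs = mat_diag (length vs) (\<lambda>i. ecc G (vs ! i))"

definition ecc_laplacian :: "('a, 'b) pre_digraph \<Rightarrow> 'a list \<Rightarrow> real mat" where
  "ecc_laplacian G vs = ecc_mat G vs - adj_mat G vs"

text \<open>
  Eigenvalues with algebraic multiplicity. Only real roots are collected, which are all
  \<open>n\<close> roots in the case at hand because \<^const>\<open>ecc_laplacian\<close> is symmetric.
\<close>

definition eigenvalues_mset :: "real mat \<Rightarrow> real multiset" where
  "eigenvalues_mset A = proots (char_poly A)"

definition ecc_deviations :: "('a, 'b) pre_digraph \<Rightarrow> 'a list \<Rightarrow> real multiset" where
  "ecc_deviations G vs =
     {#\<bar>\<mu>' - total_ecc G / real (card (verts G))\<bar>. \<mu>' \<in># eigenvalues_mset (ecc_laplacian G vs)#}"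

definition ecc_laplacian_energy :: "('a, 'b) pre_digraph \<Rightarrow> 'a list \<Rightarrow> real" where
  "ecc_laplacian_energy G vs = sum_mset (ecc_deviations G vs)"

end

theory Submission
  imports Defs "Jordan_Normal_Form.Schur_Decomposition"
begin

text \<open>
  Since the diagonal of \<open>A\<close> vanishes, the matrix \<open>\<epsilon> - A\<close> has trace \<open>\<zeta>\<close> and its square has
  trace \<open>E\<^sub>1 + 2m\<close>. All \<open>n\<close> eigenvalues are real, so \<open>n\<close> times the sum of the squared
  deviations is \<open>n E\<^sub>1 - \<zeta>\<^sup>2 + 2mn\<close>. Popoviciu's inequality for the variance of the
  absolute deviations bounds the difference between this and the squared energy.
\<close>

section \<open>Traces, similarity and triangular matrices\<close>

definition trace_mat :: "'a :: comm_monoid_add mat \<Rightarrow> 'a" where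
  "trace_mat A = (\<Sum>i<dim_row A. A $$ (i, i))"

lemma trace_mat_mult:
  fixes A B :: "'a :: comm_semiring_0 mat"
  assumes "A \<in> carrier_mat n k" "B \<in> carrier_mat k n"
  shows "trace_mat (A * B) = (\<Sum>i<n. \<Sum>j<k. A $$ (i, j) * B $$ (j, i))"
  using assms by (auto simp: trace_mat_def scalar_prod_def atLeast0LessThan intro!: sum.cong)

lemma trace_mat_mult_commute:
  fixes A B :: "'a :: comm_semiring_0 mat"
  assumes "A \<in> carrier_mat n k" "B \<in> carrier_mat k n"
  shows "trace_mat (A * B) = trace_mat (B * A)"
  unfolding trace_mat_mult[OF assms] trace_mat_mult[OF assms(2,1)]
  by (subst sum.swap) (simp add: mult.commute)

lemma trace_mat_similar_wit:
  fixes A B :: "'a :: comm_ring_1 mat"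
  assumes A: "A \<in> carrier_mat n n" and sim: "similar_mat_wit A B P Q"
  shows "trace_mat A = trace_mat B"
proof -
  note wit = similar_mat_witD2[OF A sim]
  have "trace_mat A = trace_mat ((P * B) * Q)"
    using wit by simp
  also have "\<dots> = trace_mat (Q * (P * B))"
    using wit by (intro trace_mat_mult_commute[of _ n n]) auto
  also have "Q * (P * B) = (Q * P) * B"
    using wit by (intro assoc_mult_mat[symmetric]) auto
  also have "\<dots> = B"
    using wit by simp
  finally show ?thesis .
qed

text \<open>The witnesses \<open>P\<close> and \<open>Q\<close> that conjugate \<open>B\<close> into
  \<open>A\<close> also conjugate the square of \<open>B\<close> into that of \<open>A\<close>, so
  invariance of the trace applies to the squares.\<close>

lemma trace_mat_square_similar_wit:
  fixes A B :: "'a :: comm_ring_1 mat"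
  assumes A: "A \<in> carrier_mat n n" and sim: "similar_mat_wit A B P Q"
  shows "trace_mat (A * A) = trace_mat (B * B)"
proof -
  have B: "B \<in> carrier_mat n n"
    using similar_mat_witD2[OF A sim] by auto
  have "similar_mat_wit (A ^\<^sub>m 2) (B ^\<^sub>m 2) P Q"
    by (rule similar_mat_wit_pow[OF sim])
  moreover have "A ^\<^sub>m 2 = A * A" "B ^\<^sub>m 2 = B * B"
    using A B by (simp_all add: numeral_2_eq_2)
  ultimately show ?thesis
    using trace_mat_similar_wit[of "A * A" n "B * B" P Q] A by simp
qed

lemma trace_mat_square_upper_triangular:
  fixes B :: "'a :: comm_ring_1 mat"
  assumes B: "B \<in> carrier_mat n n" and ut: "upper_triangular B"
  shows "trace_mat (B * B) = (\<Sum>i<n. (B $$ (i, i))\<^sup>2)"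
proof -
  have "(\<Sum>j<n. B $$ (i, j) * B $$ (j, i)) = (B $$ (i, i))\<^sup>2" if i: "i < n" for i
  proof -
    \<comment> \<open>One of the positions \<open>(i, j)\<close> and \<open>(j, i)\<close> lies
      strictly below the diagonal.\<close>
    have "B $$ (i, j) * B $$ (j, i) = 0" if "j < n" "j \<noteq> i" for j
      using upper_triangularD[OF ut, of i j] upper_triangularD[OF ut, of j i] that i B
      by (cases "i < j") auto
    then have "(\<Sum>j<n. B $$ (i, j) * B $$ (j, i)) = (\<Sum>j\<in>{i}. B $$ (i, j) * B $$ (j, i))"
      using i by (intro sum.mono_neutral_right) auto
    then show ?thesis
      by (simp add: power2_eq_square)
  qed
  then show ?thesis
    unfolding trace_mat_mult[OF B B] by simp
qed

text \<open>Schur decomposition makes \<open>A\<close> similar to an upper triangular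
  \<open>B\<close> with diagonal exactly \<open>es\<close>. The first two power sums of the
  eigenvalues are then traces, which can be computed from the entries of \<open>A\<close> without
  knowing the eigenvalues.\<close>

lemma trace_mat_linear_factors:
  fixes A :: "'a :: conjugatable_ordered_field mat"
  assumes A: "A \<in> carrier_mat n n" and cp: "char_poly A = (\<Prod>e\<leftarrow>es. [:- e, 1:])"
  shows "trace_mat A = sum_list es"
    and "trace_mat (A * A) = (\<Sum>e\<leftarrow>es. e\<^sup>2)"
    and "length es = n"
proof -
  obtain B P Q where "schur_decomposition A es = (B, P, Q)"
    by (cases "schur_decomposition A es")
  from schur_decomposition[OF A cp this]
  have sim: "similar_mat_wit A B P Q" and ut: "upper_triangular B" and es: "diag_mat B = es"
    by auto
  have B: "B \<in> carrier_mat n n"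
    using similar_mat_witD2[OF A sim] by auto
  show "length es = n"
    using B unfolding es[symmetric] diag_mat_def by simp
  show "trace_mat A = sum_list es"
    unfolding trace_mat_similar_wit[OF A sim] unfolding es[symmetric] diag_mat_def trace_mat_def
    by (simp add: interv_sum_list_conv_sum_set_nat atLeast0LessThan)
  show "trace_mat (A * A) = (\<Sum>e\<leftarrow>es. e\<^sup>2)"
    using B unfolding trace_mat_square_similar_wit[OF A sim]
      trace_mat_square_upper_triangular[OF B ut] es[symmetric] diag_mat_def
    by (simp add: interv_sum_list_conv_sum_set_nat atLeast0LessThan o_def)
qed

section \<open>Real spectrum of symmetric matrices\<close>

lemma eigenvalue_real_symmetric:
  fixes A :: "real mat"
  assumes A: "A \<in> carrier_mat n n"
    and sym: "\<And>i j. i < n \<Longrightarrow> j < n \<Longrightarrow> A $$ (i, j) = A $$ (j, i)"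
    and ev: "eigenvalue (map_mat complex_of_real A) k"
  shows "k \<in> \<real>"
proof -
  obtain v where v: "v \<in> carrier_vec n" "v \<noteq> 0\<^sub>v n"
    and Av: "map_mat complex_of_real A *\<^sub>v v = k \<cdot>\<^sub>v v"
    using ev A unfolding eigenvalue_def eigenvector_def by auto
  \<comment> \<open>\<open>N\<close> is the squared Hermitian norm of the eigenvector
    \<open>v\<close>: real, and nonzero because \<open>v\<close> is.\<close>
  define N where "N = (\<Sum>i<n. cnj (v $ i) * v $ i)"
  have row: "(\<Sum>j<n. of_real (A $$ (i, j)) * v $ j) = k * v $ i" if "i < n" for i
  proof -
    have "(map_mat complex_of_real A *\<^sub>v v) $ i = (\<Sum>j<n. of_real (A $$ (i, j)) * v $ j)"
      using that A v by (auto simp: scalar_prod_def atLeast0LessThan intro!: sum.cong)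
    then show ?thesis
      using that v Av by simp
  qed
  have N_real: "N = of_real (\<Sum>i<n. (cmod (v $ i))\<^sup>2)"
    unfolding N_def of_real_sum
    by (intro sum.cong) (simp_all only: complex_norm_square mult.commute)
  have "N \<noteq> 0"
  proof
    assume "N = 0"
    then have "(\<Sum>i<n. (cmod (v $ i))\<^sup>2) = 0"
      using N_real by (simp only: of_real_eq_0_iff)
    then have "\<forall>i<n. v $ i = 0"
      by (subst (asm) sum_nonneg_eq_0_iff) auto
    then have "v = 0\<^sub>v n"
      using v by (intro eq_vecI) auto
    with v show False by simp
  qed
  \<comment> \<open>The Hermitian form of \<open>A\<close> at \<open>v\<close> equals
    \<open>k * N\<close>. Conjugation fixes the real entries of \<open>A\<close> and exchanges
    \<open>v\<close> with its conjugate; swapping the two sums and using symmetry restores the form,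
    so \<open>k * N\<close> is its own conjugate.\<close>
  have form: "(\<Sum>i<n. cnj (v $ i) * (\<Sum>j<n. of_real (A $$ (i, j)) * v $ j)) = k * N"
    by (simp add: row N_def sum_distrib_left mult.left_commute)
  have "cnj k * N = cnj (k * N)"
    using N_real by simp
  also have "\<dots> = (\<Sum>i<n. \<Sum>j<n. v $ i * (of_real (A $$ (i, j)) * cnj (v $ j)))"
    unfolding form[symmetric] by (simp add: sum_distrib_left)
  also have "\<dots> = (\<Sum>j<n. \<Sum>i<n. v $ i * (of_real (A $$ (i, j)) * cnj (v $ j)))"
    by (rule sum.swap)
  also have "\<dots> = k * N"
    unfolding form[symmetric]
    by (auto simp: sum_distrib_left sym mult_ac intro!: sum.cong)
  finally have "cnj k = k"
    using \<open>N \<noteq> 0\<close> by simp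
  then show ?thesis
    by (simp add: Reals_cnj_iff)
qed

text \<open>Over the complex numbers the characteristic polynomial splits, and all its roots
  \<open>k\<close> are real. Replacing each \<open>k\<close> by \<open>Re k\<close> gives the image
  of a real product, and the embedding of real polynomials is injective.\<close>

lemma char_poly_real_symmetric:
  fixes A :: "real mat"
  assumes A: "A \<in> carrier_mat n n"
    and sym: "\<And>i j. i < n \<Longrightarrow> j < n \<Longrightarrow> A $$ (i, j) = A $$ (j, i)"
  shows "\<exists>es. char_poly A = (\<Prod>e\<leftarrow>es. [:- e, 1:])"
proof -
  interpret P: map_poly_inj_comm_ring_hom complex_of_real ..
  let ?A = "map_mat complex_of_real A"
  have A': "?A \<in> carrier_mat n n"
    using A by simp
  obtain ks where ks: "char_poly ?A = (\<Prod>k\<leftarrow>ks. [:- k, 1:])"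
    using char_poly_factorized[OF A'] by blast
  have real: "k \<in> \<real>" if "k \<in> set ks" for k
  proof -
    have "poly (char_poly ?A) k = 0"
      using that unfolding ks by (auto simp: poly_prod_list prod_list_zero_iff)
    then show ?thesis
      using eigenvalue_real_symmetric[OF A sym] eigenvalue_root_char_poly[OF A'] by blast
  qed
  have "map_poly complex_of_real (char_poly A) = (\<Prod>k\<leftarrow>ks. [:- k, 1:])"
    unfolding ks[symmetric] by (rule of_real_hom.char_poly_hom[OF A, symmetric])
  also have "\<dots> = (\<Prod>k\<leftarrow>ks. map_poly complex_of_real [:- Re k, 1:])"
    by (intro arg_cong[where f = prod_list] map_cong) (auto dest!: real elim: Reals_cases)
  also have "\<dots> = map_poly complex_of_real (\<Prod>e\<leftarrow>map Re ks. [:- e, 1:])"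
    by (simp add: P.hom_prod_list o_def)
  finally have "char_poly A = (\<Prod>e\<leftarrow>map Re ks. [:- e, 1:])"
    by (rule P.injectivity)
  then show ?thesis
    by blast
qed

lemma proots_linear_factors:
  fixes es :: "'a :: idom list"
  shows "proots (\<Prod>e\<leftarrow>es. [:- e, 1:]) = mset es"
proof (induction es)
  case (Cons e es)
  have "(\<Prod>e\<leftarrow>es. [:- e, 1:]) \<noteq> 0"
    by (auto simp: prod_list_zero_iff)
  then show ?case
    using Cons by (simp add: proots_mult del: mult_pCons_left)
qed simp

section \<open>Variance: Popoviciu's inequality and the sum of squared deviations\<close>

lemma popoviciu_list:
  fixes xs :: "real list"
  assumes bounds: "\<And>x. x \<in> set xs \<Longrightarrow> a \<le> x \<and> x \<le> b"
  shows "real (length xs) * (\<Sum>x\<leftarrow>xs. x\<^sup>2) - (sum_list xs)\<^sup>2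
    \<le> (real (length xs))\<^sup>2 / 4 * (b - a)\<^sup>2"
proof -
  let ?n = "real (length xs)" and ?s = "sum_list xs" and ?q = "\<Sum>x\<leftarrow>xs. x\<^sup>2"
  \<comment> \<open>For \<open>x\<close> between \<open>a\<close> and \<open>b\<close> the product
    \<open>(x - a) * (b - x)\<close> is nonnegative; summing it bounds the sum of squares by a
    linear expression in the sum.\<close>
  have "(\<Sum>x\<leftarrow>xs. (x - a) * (b - x)) = (a + b) * ?s - ?q - ?n * a * b"
    by (induction xs) (simp_all add: algebra_simps power2_eq_square)
  moreover have "(\<Sum>x\<leftarrow>xs. (x - a) * (b - x)) \<ge> 0"
    using bounds by (intro sum_list_nonneg) (auto intro!: mult_nonneg_nonneg)
  ultimately have "?n * ?q \<le> ?n * ((a + b) * ?s - ?n * a * b)"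
    by (intro mult_left_mono) auto
  \<comment> \<open>Completing the square in \<open>?s\<close>; the subtracted square vanishes
    exactly when \<open>?s\<close> is \<open>?n\<close> times the midpoint of \<open>a\<close> and
    \<open>b\<close>.\<close>
  also have "\<dots> = ?s\<^sup>2 + ?n\<^sup>2 / 4 * (b - a)\<^sup>2 - (?s - ?n * (a + b) / 2)\<^sup>2"
    by (simp add: power2_eq_square field_simps)
  also have "\<dots> \<le> ?s\<^sup>2 + ?n\<^sup>2 / 4 * (b - a)\<^sup>2"
    by simp
  finally show ?thesis
    by simp
qed

lemma sum_list_square_deviations:
  fixes xs :: "real list" and s :: real
  assumes "s = sum_list xs"
  shows "real (length xs) * (\<Sum>x\<leftarrow>xs. \<bar>x - s / real (length xs)\<bar>\<^sup>2)
    = real (length xs) * (\<Sum>x\<leftarrow>xs. x\<^sup>2) - s\<^sup>2"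
proof (cases "xs = []")
  \<comment> \<open>For the empty list the quotient is a division by zero, but both sides are
    0.\<close>
  case True
  then show ?thesis using assms by simp
next
  case False
  let ?n = "real (length xs)"
  have "(\<Sum>x\<leftarrow>xs. (x - c)\<^sup>2) = (\<Sum>x\<leftarrow>xs. x\<^sup>2) - 2 * c * sum_list xs + real (length xs) * c\<^sup>2" for c
    by (induction xs) (simp_all add: algebra_simps power2_eq_square)
  from this[of "s / ?n"] have "(\<Sum>x\<leftarrow>xs. \<bar>x - s / ?n\<bar>\<^sup>2)
      = (\<Sum>x\<leftarrow>xs. x\<^sup>2) - 2 * (s / ?n) * s + ?n * (s / ?n)\<^sup>2"
    using assms by simp
  also have "?n * \<dots> = ?n * (\<Sum>x\<leftarrow>xs. x\<^sup>2) - s\<^sup>2"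
    using False by (simp add: field_simps power2_eq_square)
  finally show ?thesis
    by simp
qed

section \<open>Edge count and traces of the eccentricity Laplacian\<close>

lemma (in graph) card_arcs_ends: "card (arcs_ends G) = 2 * graph_size G"
proof -
  let ?f = "\<lambda>(u, v). {u, v}"
  let ?S = "?f ` arcs_ends G"
  have fin: "finite (arcs_ends G)"
    unfolding arcs_ends_def by simp
  \<comment> \<open>Forgetting the order of a pair is two-to-one on adjacent pairs: symmetry
    supplies the reversed pair, and the absence of loops makes it a different one.\<close>
  have fibre: "card {p \<in> arcs_ends G. ?f p = X} = 2" if X: "X \<in> ?S" for X
  proof -
    obtain u v where uv: "(u, v) \<in> arcs_ends G" "X = {u, v}"
      using X by auto
    have "u \<noteq> v"
      using uv(1) no_loops by (auto simp: arcs_ends_def arc_to_ends_def)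
    have vu: "(v, u) \<in> arcs_ends G"
      using uv(1) by (rule arcs_ends_symmetric[OF sym_arcs])
    have eq: "?f p = X \<longleftrightarrow> p = (u, v) \<or> p = (v, u)" for p
      by (cases p) (simp only: uv(2) prod.case doubleton_eq_iff prod.inject)
    have "{p \<in> arcs_ends G. ?f p = X} = {(u, v), (v, u)}"
      unfolding eq using uv(1) vu by auto
    then show ?thesis
      using \<open>u \<noteq> v\<close> by simp
  qed
  have "card (arcs_ends G) = (\<Sum>X\<in>?S. card {p \<in> arcs_ends G. ?f p = X})"
    using sum.image_gen[OF fin, of "\<lambda>_. 1 :: nat" ?f] by simp
  also have "\<dots> = 2 * card ?S"
    by (simp add: fibre)
  also have "?S = (\<lambda>e. {tail G e, head G e}) ` arcs G"
    by (simp add: arcs_ends_def arc_to_ends_def image_image)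
  finally show ?thesis
    by (simp add: graph_size_def)
qed

lemma sum_nth_distinct:
  assumes "distinct xs"
  shows "(\<Sum>i<length xs. f (xs ! i)) = sum f (set xs)"
  using sum.reindex_bij_betw[OF bij_betw_nth[OF assms refl refl]] .

lemma ecc_laplacian_index:
  assumes "i < length vs" "j < length vs"
  shows "ecc_laplacian G vs $$ (i, j)
    = (if i = j then ecc G (vs ! i) else 0) - (if vs ! i \<rightarrow>\<^bsub>G\<^esub> vs ! j then 1 else 0)"
  using assms by (simp add: ecc_laplacian_def ecc_mat_def adj_mat_def mat_diag_def)

lemma ecc_laplacian_carrier: "ecc_laplacian G vs \<in> carrier_mat (length vs) (length vs)"
  by (auto simp: ecc_laplacian_def ecc_mat_def adj_mat_def mat_diag_def)

context graph
begin

lemma not_adj_self: "\<not> u \<rightarrow>\<^bsub>G\<^esub> u"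
  using no_loops by (auto simp: arcs_ends_def arc_to_ends_def)

lemma ecc_laplacian_symmetric:
  assumes "i < length vs" "j < length vs"
  shows "ecc_laplacian G vs $$ (i, j) = ecc_laplacian G vs $$ (j, i)"
  using assms arcs_ends_symmetric[OF sym_arcs]
  by (auto simp: ecc_laplacian_index)

context
  fixes vs :: "'a list"
  assumes vs: "distinct vs" "set vs = verts G"
begin

lemma trace_ecc_laplacian: "trace_mat (ecc_laplacian G vs) = total_ecc G"
proof -
  have "trace_mat (ecc_laplacian G vs) = (\<Sum>i<length vs. ecc G (vs ! i))"
    using ecc_laplacian_carrier[of G vs]
    by (auto simp: trace_mat_def ecc_laplacian_index not_adj_self)
  then show ?thesis
    by (simp add: sum_nth_distinct vs total_ecc_def)
qed

text \<open>By symmetry the trace of the square is the sum of all squared entries. Diagonal entries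
  contribute \<open>first_zagreb_ecc G\<close>; each ordered adjacent pair contributes 1, hence
  every edge 2.\<close>

lemma trace_ecc_laplacian_square:
  "trace_mat (ecc_laplacian G vs * ecc_laplacian G vs)
    = first_zagreb_ecc G + 2 * real (graph_size G)"
proof -
  let ?L = "ecc_laplacian G vs" and ?n = "length vs"
  let ?a = "\<lambda>u v. if u \<rightarrow>\<^bsub>G\<^esub> v then 1 else 0 :: real"
  have "trace_mat (?L * ?L) = (\<Sum>i<?n. \<Sum>j<?n. (?L $$ (i, j))\<^sup>2)"
    unfolding trace_mat_mult[OF ecc_laplacian_carrier ecc_laplacian_carrier]
    by (auto simp: power2_eq_square ecc_laplacian_symmetric[of _ vs _] intro!: sum.cong)
  \<comment> \<open>No cross term arises: the eccentricities sit on the diagonal, where the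
    adjacency matrix vanishes.\<close>
  also have "\<dots> = (\<Sum>i<?n. \<Sum>j<?n. (if i = j then (ecc G (vs ! i))\<^sup>2 else 0) + ?a (vs ! i) (vs ! j))"
    by (intro sum.cong) (auto simp: ecc_laplacian_index not_adj_self)
  also have "\<dots> = (\<Sum>i<?n. (ecc G (vs ! i))\<^sup>2) + (\<Sum>i<?n. \<Sum>j<?n. ?a (vs ! i) (vs ! j))"
    by (simp add: sum.distrib)
  also have "(\<Sum>i<?n. (ecc G (vs ! i))\<^sup>2) = first_zagreb_ecc G"
    by (simp add: sum_nth_distinct[OF vs(1), of "\<lambda>v. (ecc G v)\<^sup>2"] vs(2) first_zagreb_ecc_def)
  also have "(\<Sum>i<?n. \<Sum>j<?n. ?a (vs ! i) (vs ! j)) = (\<Sum>u\<in>verts G. \<Sum>v\<in>verts G. ?a u v)"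
    by (simp add: sum_nth_distinct[OF vs(1), of "?a _"]
        sum_nth_distinct[OF vs(1), of "\<lambda>u. \<Sum>v\<in>verts G. ?a u v"] vs(2))
  also have "\<dots> = (\<Sum>p\<in>verts G \<times> verts G. if p \<in> arcs_ends G then 1 else 0)"
    by (simp add: sum.cartesian_product case_prod_unfold)
  also have "\<dots> = (\<Sum>p\<in>(verts G \<times> verts G) \<inter> arcs_ends G. 1)"
    by (rule sum.inter_restrict[symmetric]) simp
  also have "(verts G \<times> verts G) \<inter> arcs_ends G = arcs_ends G"
    by (auto simp: arcs_ends_def arc_to_ends_def)
  finally show ?thesis
    by (simp add: card_arcs_ends)
qed

end

end

theorem theorem2:
  fixes G :: "('a, 'b) pre_digraph" and vs :: "'a list" and n m :: nat and \<nu>1 \<nu>n :: real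
  assumes "graph G" and "Digraph_Component.connected G"
    and "distinct vs" and "set vs = verts G"
    and "n = card (verts G)" and "m = graph_size G"
    and "\<nu>1 = Max (set_mset (ecc_deviations G vs))"
    and "\<nu>n = Min (set_mset (ecc_deviations G vs))"
  shows "ecc_laplacian_energy G vs \<ge>
    sqrt (real n * first_zagreb_ecc G - (total_ecc G)\<^sup>2 + 2 * real m * real n
          - (real n)\<^sup>2 / 4 * (\<nu>1 - \<nu>n)\<^sup>2)"
proof -
  interpret graph G by fact
  let ?L = "ecc_laplacian G vs"
  have n: "length vs = n"
    using assms distinct_card by metis
  have L: "?L \<in> carrier_mat n n"
    using ecc_laplacian_carrier[of G vs] n by simp
  \<comment> \<open>All eigenvalues with multiplicity, as a list of \<open>n\<close> reals.\<close>
  obtain es where es: "char_poly ?L = (\<Prod>e\<leftarrow>es. [:- e, 1:])"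
    using char_poly_real_symmetric[OF L] ecc_laplacian_symmetric n by metis
  note traces = trace_mat_linear_factors[OF L es]
  have sum_es: "total_ecc G = sum_list es"
    using traces(1) trace_ecc_laplacian[OF assms(3,4)] by simp
  have sum_es2: "(\<Sum>e\<leftarrow>es. e\<^sup>2) = first_zagreb_ecc G + 2 * real m"
    using traces(2) trace_ecc_laplacian_square[OF assms(3,4)] assms(6) by simp
  define ds where "ds = map (\<lambda>e. \<bar>e - total_ecc G / real n\<bar>) es"
  have dev: "ecc_deviations G vs = mset ds"
    unfolding ecc_deviations_def eigenvalues_mset_def es proots_linear_factors ds_def assms(5)
    by simp
  have energy: "ecc_laplacian_energy G vs = sum_list ds"
    unfolding ecc_laplacian_energy_def dev by (rule sum_mset_sum_list)
  \<comment> \<open>The mean of \<open>es\<close> is \<open>total_ecc G / real n\<close>, so this is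
    the variance identity with the two traces inserted.\<close>
  have sum_ds2: "real n * (\<Sum>d\<leftarrow>ds. d\<^sup>2)
      = real n * first_zagreb_ecc G - (total_ecc G)\<^sup>2 + 2 * real m * real n"
    using sum_list_square_deviations[OF sum_es] traces(3) sum_es2
    by (simp add: ds_def o_def algebra_simps)
  \<comment> \<open>Popoviciu's inequality for the absolute deviations, which all lie between their
    minimum \<open>\<nu>n\<close> and their maximum \<open>\<nu>1\<close>.\<close>
  have "real n * (\<Sum>d\<leftarrow>ds. d\<^sup>2) - (sum_list ds)\<^sup>2 \<le> (real n)\<^sup>2 / 4 * (\<nu>1 - \<nu>n)\<^sup>2"
    using popoviciu_list[of ds \<nu>n \<nu>1] traces(3) unfolding assms(7,8) dev
    by (simp add: ds_def)
  \<comment> \<open>The bound so far concerns the square of the energy; nonnegativity of the energy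
    allows passing to the square root.\<close>
  moreover have "0 \<le> sum_list ds"
    by (rule sum_list_nonneg) (auto simp: ds_def)
  ultimately show ?thesis
    unfolding energy by (intro real_le_lsqrt) (simp_all add: sum_ds2)
qed

end
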